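(* Let $\mathcal{A}$ be a complex Banach algebra with identity $1$ and let $a\in\mathcal{A}$. Then the following are equivalent: (1) $a\in\mathcal{A}^d$, i.e. $a$ has a g-Drazin inverse; (2) there exists an idempotent $e\in comm(a)$ such that $eae\in[e\mathcal{A}e]^{-1}$ and $(1-e)a(1-e)\in[(1-e)\mathcal{A}(1-e)]^{qnil}$.
   Context: An element $w$ of a Banach algebra $\mathcal{B}$ is quasinilpotent if $\lim_{n\to\infty}\|w^n\|^{1/n}=0$; $\mathcal{B}^{qnil}$ denotes the set of quasinilpotent elements of $\mathcal{B}$ and $\mathcal{B}^{-1}$ the set of units (invertible elements) of $\mathcal{B}$. For an idempotent $e\in\mathcal{A}$, $e\mathcal{A}e=\{exe: x\in\mathcal{A}\}$ is regarded as a Banach algebra with identity $e$ (possibly the zero algebra), and similarly for $(1-e)\mathcal{A}(1-e)$ with identity $1-e$. An element $a\in\mathcal{A}$ has a g-Drazin inverse (generalized Drazin inverse) if there exists $b\in\mathcal{A}$ such that $ab=ba$, $b=bab$ and $a-a^2b\in\mathcal{A}^{qnil}$; such $b$ is unique if it exists and is denoted $a^d$. $\mathcal{A}^d$ denotes the set of all elements of $\mathcal{A}$ having a g-Drazin inverse. The commutant is $comm(a)=\{x\in\mathcal{A}: xa=ax\}$. *)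

theory Defs
  imports Complex_Main
begin

text \<open>
  The distribution has only real normed algebras, so the complex scalar multiplication is
  added here. The identity comes from \<^class>\<open>monoid_mult\<close> rather than from
  \<^class>\<open>real_normed_algebra_1\<close>, because the latter also requires \<open>0 \<noteq> 1\<close> and
  \<open>norm 1 = 1\<close>; neither is assumed here.
\<close>

class complex_banach_algebra = real_normed_algebra + banach + monoid_mult +
  fixes scaleC :: "complex \<Rightarrow> 'a \<Rightarrow> 'a"  (infixr \<open>*\<^sub>C\<close> 75)
  assumes scaleC_add_right: "c *\<^sub>C (x + y) = c *\<^sub>C x + c *\<^sub>C y"
    and scaleC_add_left: "(c + d) *\<^sub>C x = c *\<^sub>C x + d *\<^sub>C x"
    and scaleC_scaleC: "c *\<^sub>C (d *\<^sub>C x) = (c * d) *\<^sub>C x"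
    and scaleR_eq_scaleC: "r *\<^sub>R x = complex_of_real r *\<^sub>C x"
    and mult_scaleC_left: "(c *\<^sub>C x) * y = c *\<^sub>C (x * y)"
    and mult_scaleC_right: "x * (c *\<^sub>C y) = c *\<^sub>C (x * y)"
    and norm_scaleC: "norm (c *\<^sub>C x) = cmod c * norm x"

instantiation complex :: complex_banach_algebra
begin

definition scaleC_complex :: "complex \<Rightarrow> complex \<Rightarrow> complex"
  where "scaleC_complex c x = c * x"

instance
  by standard
    (simp_all add: scaleC_complex_def algebra_simps norm_mult scaleR_conv_of_real)

end

text \<open>
  The algebras considered are the whole algebra, with carrier \<^term>\<open>UNIV\<close> and identity
  \<open>1\<close>, and its corners \<open>eAe\<close>, with the inherited operations and norm but identity \<open>e\<close>.
  Units are therefore taken relative to a carrier \<open>B\<close> and its identity \<open>u\<close>.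
\<close>

definition corner :: "'a::complex_banach_algebra \<Rightarrow> 'a set"
  where "corner e = {e * x * e | x. True}"

definition units_in :: "'a::complex_banach_algebra set \<Rightarrow> 'a \<Rightarrow> 'a set"
  where "units_in B u = {x \<in> B. \<exists>y\<in>B. x * y = u \<and> y * x = u}"

text \<open>
  For \<open>n \<ge> 1\<close> the power \<open>w ^ n\<close> does not depend on which identity is used;
  the term at \<open>n = 0\<close> does not affect the limit.
\<close>

definition qnil_in :: "'a::complex_banach_algebra set \<Rightarrow> 'a set"
  where "qnil_in B = {w \<in> B. (\<lambda>n. root n (norm (w ^ n))) \<longlonglongrightarrow> 0}"

definition comm :: "'a::complex_banach_algebra \<Rightarrow> 'a set"
  where "comm a = {x. x * a = a * x}"

definition is_gDrazin_inverse :: "'a::complex_banach_algebra \<Rightarrow> 'a \<Rightarrow> bool"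
  where "is_gDrazin_inverse a b \<longleftrightarrow>
    a * b = b * a \<and> b = b * a * b \<and> a - a ^ 2 * b \<in> qnil_in UNIV"

definition gDrazin_invertibles :: "'a::complex_banach_algebra set"
  where "gDrazin_invertibles = {a. \<exists>b. is_gDrazin_inverse a b}"

end

theory Submission
  imports Defs
begin

text \<open>A g-Drazin inverse \<open>b\<close> and an idempotent \<open>e\<close> determine each
  other: \<open>e = a * b\<close>, and \<open>b\<close> is the inverse of \<open>e * a * e\<close>
  inside the corner of \<open>e\<close>. As \<open>e\<close> commutes with \<open>a\<close>, the
  part of \<open>a\<close> in the complementary corner is \<open>a - a * e\<close>, which is
  \<open>a - a ^ 2 * b\<close> (\<open>complementary_corner_eq\<close>). So both quasinilpotence
  conditions concern one element, and a corner inherits norm and powers, so the limit condition is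
  the same in both.\<close>

lemma complementary_corner_eq:
  fixes a e :: "'a::complex_banach_algebra"
  assumes "e * e = e" "e * a = a * e"
  shows "(1 - e) * a * (1 - e) = a - a * e"
proof -
  have "e * (a * e) = a * e"
    using assms by (metis mult.assoc)
  then show ?thesis
    using assms by (simp add: left_diff_distrib right_diff_distrib mult.assoc)
qed

text \<open>Multiplying \<open>b * a * b = b\<close> by \<open>a\<close> makes \<open>a * b\<close>
  idempotent; it acts as an identity on \<open>b\<close>, so \<open>b\<close> can serve as an
  inverse within its corner.\<close>

lemma gDrazin_inverse_imp_idempotent:
  fixes a b :: "'a::complex_banach_algebra"
  assumes "is_gDrazin_inverse a b"
  shows "a * b \<in> comm a \<and> (a * b) * (a * b) = a * b \<and>
    (a * b) * a * (a * b) \<in> units_in (corner (a * b)) (a * b) \<and>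
    (1 - a * b) * a * (1 - a * b) \<in> qnil_in (corner (1 - a * b))"
proof -
  define e where "e = a * b"
  have ab: "a * b = b * a" and bab: "b * a * b = b" and q: "a - a ^ 2 * b \<in> qnil_in UNIV"
    using assms unfolding is_gDrazin_inverse_def by simp_all
  have ee: "e * e = e" and eb: "e * b = b" and be: "b * e = b"
    using ab bab unfolding e_def by (metis mult.assoc)+
  have ea: "e * a = a * e"
    using ab unfolding e_def by (metis mult.assoc)
  have "(e * a * e) * b = e" "b * (e * a * e) = e"
    using ee eb be ab unfolding e_def by (metis mult.assoc)+
  \<comment> \<open>This places \<open>b\<close> in the corner, as relative invertibility
    demands.\<close>
  moreover have "b = e * b * e"
    using eb be by simp
  ultimately have unit: "e * a * e \<in> units_in (corner e) e"
    unfolding units_in_def corner_def by blast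
  have "(1 - e) * a * (1 - e) = a - a ^ 2 * b"
    using complementary_corner_eq[OF ee ea] by (simp add: e_def power2_eq_square mult.assoc)
  \<comment> \<open>Only membership in the smaller carrier is new, and the form of the left-hand
    side shows it.\<close>
  with q have "(1 - e) * a * (1 - e) \<in> qnil_in (corner (1 - e))"
    unfolding qnil_in_def corner_def by (auto intro: exI[of _ a])
  with unit ee ea show ?thesis
    unfolding comm_def e_def by simp
qed

text \<open>The corner inverse \<open>y\<close> of \<open>e * a * e\<close> is itself the g-Drazin
  inverse.\<close>

lemma idempotent_imp_gDrazin_inverse:
  fixes a e :: "'a::complex_banach_algebra"
  assumes comm: "e \<in> comm a" and ee: "e * e = e"
    and unit: "e * a * e \<in> units_in (corner e) e"
    and q: "(1 - e) * a * (1 - e) \<in> qnil_in (corner (1 - e))"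
  shows "\<exists>b. is_gDrazin_inverse a b"
proof -
  have ea: "e * a = a * e"
    using comm by (simp add: comm_def)
  obtain y where y: "y \<in> corner e" "(e * a * e) * y = e" "y * (e * a * e) = e"
    using unit unfolding units_in_def by blast
  have ey: "e * y = y" and ye: "y * e = y"
    using y(1) ee unfolding corner_def by (auto simp: mult.assoc) (metis mult.assoc)
  \<comment> \<open>Since \<open>y = e * y\<close> and \<open>e\<close> commutes with
    \<open>a\<close>, \<open>a * y = (e * a * e) * y\<close>; symmetrically on the other
    side.\<close>
  have ay: "a * y = e" and ya: "y * a = e"
    using y(2,3) ea ee ey ye by (metis mult.assoc)+
  have "(1 - e) * a * (1 - e) = a - a ^ 2 * y"
    using complementary_corner_eq[OF ee ea] ay by (simp add: power2_eq_square mult.assoc)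
  with q have "a - a ^ 2 * y \<in> qnil_in UNIV"
    unfolding qnil_in_def by simp
  then have "is_gDrazin_inverse a y"
    unfolding is_gDrazin_inverse_def using ay ya ey by simp
  then show ?thesis ..
qed

theorem theorem2p7:
  fixes a :: "'a::complex_banach_algebra"
  shows "a \<in> gDrazin_invertibles \<longleftrightarrow>
    (\<exists>e\<in>comm a. e * e = e \<and>
      e * a * e \<in> units_in (corner e) e \<and>
      (1 - e) * a * (1 - e) \<in> qnil_in (corner (1 - e)))"
  unfolding gDrazin_invertibles_def
  using gDrazin_inverse_imp_idempotent idempotent_imp_gDrazin_inverse by blast

end
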